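(* Let $n,h\ge1$ be integers and $0\le s\le\lfloor n/2\rfloor$. Then $$\sum_{i=0}^{h-1}K_{n+i}(s)=\frac12\left(K_{n+h+2}(s+1)-K_{n+2}(s+1)+K_n(s)-K_{n+h}(s)\right).$$
   Context: Binomial coefficients satisfy $\binom{m}{k}=0$ for $k>m$. For a positive integer $m$ and $0\le t\le\lfloor m/2\rfloor$, the incomplete Tribonacci-Lucas number is $$K_m(t)=\sum_{i=0}^{t}\ \sum_{\substack{0\le j\le i\\ i+j<m}}\frac{m}{m-i-j}\binom{i}{j}\binom{m-i-j}{i}.$$ *)

theory Defs
  imports Complex_Main
begin

(* The intended domain is m > 0 and t \<le> m div 2.  The condition i + j < m keeps the
   natural-number subtraction m - i - j exact and the denominator nonzero. *)
definition inc_trib_lucas :: "nat \<Rightarrow> nat \<Rightarrow> real" where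
  "inc_trib_lucas m t =
     (\<Sum>i = 0..t. \<Sum>j \<in> {j. 0 \<le> j \<and> j \<le> i \<and> i + j < m}.
        real m / real (m - i - j) * real (i choose j) * real ((m - i - j) choose i))"

end

theory Submission
  imports Defs
begin

text \<open>
  Write \<open>r = m - i - j\<close>. The absorption identities turn each summand into a polynomial in
  binomial coefficients, and Pascal's rule then gives a termwise recurrence. Summed over \<open>j\<close> and
  \<open>i\<close> it reads \<open>K\<^sub>m\<^sub>+\<^sub>3(s+1) = K\<^sub>m\<^sub>+\<^sub>2(s+1) + K\<^sub>m\<^sub>+\<^sub>1(s) + K\<^sub>m(s)\<close> for \<open>m \<ge> 1\<close>, so
  the sum in the theorem telescopes.
\<close>

text \<open>Indexing by \<open>r\<close> in place of m = r + i + j keeps truncated subtraction out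
  of the binomial algebra.\<close>

definition trib_weight :: "nat \<Rightarrow> nat \<Rightarrow> nat \<Rightarrow> real" where
  "trib_weight r i j = real (r + i + j) / real r * real (i choose j) * real (r choose i)"

lemma trib_weight_0: "r > 0 \<Longrightarrow> trib_weight r 0 j = (if j = 0 then 1 else 0)"
  by (simp add: trib_weight_def)

lemma trib_weight_eq_0: "i < j \<Longrightarrow> trib_weight r i j = 0"
  by (simp add: trib_weight_def)

text \<open>Split the numerator as \<open>Suc q\<close> plus \<open>Suc i\<close> plus
  \<open>j\<close>. By absorption the last two parts also acquire a factor \<open>Suc q\<close>,
  which cancels the denominator.\<close>

lemma trib_weight_Suc:
  "trib_weight (Suc q) (Suc i) j =
     real (Suc i choose j) * real (Suc q choose Suc i) +
     (2 * real (Suc i choose j) - real (i choose j)) * real (q choose i)"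
proof -
  have a: "real (Suc i) * real (Suc q choose Suc i) = real (Suc q) * real (q choose i)"
    by (metis Suc_times_binomial_eq mult.commute of_nat_mult)
  \<comment> \<open>Absorption with the lower binomial rewritten by Pascal's rule, so that
    \<open>j - 1\<close> does not occur and \<open>j = 0\<close> is covered.\<close>
  have b: "real j * real (Suc i choose j) =
      real (Suc i) * (real (Suc i choose j) - real (i choose j))"
  proof (cases j)
    case (Suc k)
    have "real (Suc k) * real (Suc i choose Suc k) = real (Suc i) * real (i choose k)"
      by (metis Suc_times_binomial_eq mult.commute of_nat_mult)
    then show ?thesis by (simp add: Suc)
  qed simp
  let ?A = "real (Suc i choose j)" and ?B = "real (Suc q choose Suc i)"
  have "real (Suc q + Suc i + j) * ?A * ?B =
      real (Suc q) * ?A * ?B + (real (Suc i) * ?B) * ?A + (real j * ?A) * ?B"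
    by (simp only: of_nat_add) (simp only: algebra_simps)
  also have "\<dots> = real (Suc q) * ?A * ?B + (real (Suc i) * ?B) * ?A
      + (real (Suc i) * ?B) * (?A - real (i choose j))"
    by (simp only: b mult_ac)
  also have "\<dots> = real (Suc q) * (?A * ?B + (2 * ?A - real (i choose j)) * real (q choose i))"
    unfolding a by (simp only: algebra_simps)
  finally show ?thesis
    unfolding trib_weight_def by (simp add: divide_simps del: binomial_Suc_Suc)
qed

lemma trib_weight_rec:
  assumes "r > 0"
  shows "trib_weight (Suc r) (Suc i) j = trib_weight r (Suc i) j + trib_weight r i j +
     (case j of 0 \<Rightarrow> 0 | Suc k \<Rightarrow> trib_weight r i k)"
proof -
  obtain q where q: "r = Suc q" using assms gr0_implies_Suc by blast
  show ?thesis
  \<comment> \<open>The division-free form needs a positive second argument, so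
    \<open>trib_weight r 0 j\<close> is evaluated directly.\<close>
  proof (cases i)
    case 0
    then show ?thesis
      by (cases j) (auto simp: q trib_weight_Suc trib_weight_0 binomial_eq_0_iff algebra_simps)
  next
    case (Suc l)
    then show ?thesis
      by (cases j) (auto simp: q trib_weight_Suc algebra_simps)
  qed
qed

text \<open>Extension by zero lets the recurrence hold for all \<open>i\<close> and
  \<open>j\<close>, so whole rows can be summed.\<close>

definition trib_term :: "nat \<Rightarrow> nat \<Rightarrow> nat \<Rightarrow> real" where
  "trib_term m i j = (if i + j < m then trib_weight (m - i - j) i j else 0)"

lemma inc_trib_lucas_eq: "inc_trib_lucas m t = (\<Sum>i\<le>t. \<Sum>j\<le>i. trib_term m i j)"
proof -
  have "(\<Sum>j \<in> {j. 0 \<le> j \<and> j \<le> i \<and> i + j < m}.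
      real m / real (m - i - j) * real (i choose j) * real ((m - i - j) choose i))
      = (\<Sum>j\<le>i. trib_term m i j)" for i
    by (rule sum.mono_neutral_cong_left) (auto simp: trib_term_def trib_weight_def)
  then show ?thesis
    unfolding inc_trib_lucas_def by (simp add: atMost_atLeast0)
qed

lemma trib_term_rec:
  assumes "m > 0"
  shows "trib_term (m + 3) (Suc i) j = trib_term (m + 2) (Suc i) j + trib_term (m + 1) i j +
     (case j of 0 \<Rightarrow> 0 | Suc k \<Rightarrow> trib_term m i k)"
proof -
  consider "i + j \<le> m" | "i + j = m + 1" | "i + j > m + 1" by linarith
  then show ?thesis
  proof cases
    case 1
    \<comment> \<open>The index shifts cancel: all three terms on the right have this same
      \<open>r\<close>, the left one has \<open>Suc r\<close>.\<close>
    define r where "r = m + 1 - i - j"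
    have "r > 0" "m + 3 - Suc i - j = Suc r" "m + 2 - Suc i - j = r"
      using 1 by (auto simp: r_def)
    with 1 trib_weight_rec[of r i j] show ?thesis
      by (cases j) (auto simp: trib_term_def r_def)
  next
    \<comment> \<open>Only the left term lies inside the support, with \<open>r = 1\<close>. It
      vanishes through \<open>1 choose Suc i\<close> if \<open>i > 0\<close>, and through
      \<open>1 choose j\<close> with \<open>j = m + 1 > 1\<close> if \<open>i = 0\<close>; this is
      where \<open>m > 0\<close> enters.\<close>
    case 2
    then have "trib_weight (Suc 0) (Suc i) j = 0"
      using assms by (cases i) (auto simp: trib_weight_def binomial_eq_0_iff)
    with 2 show ?thesis
      by (cases j) (auto simp: trib_term_def Suc_diff_le)
  next
    case 3
    then show ?thesis
      by (cases j) (auto simp: trib_term_def)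
  qed
qed

lemma sum_trib_term_rec:
  assumes "m > 0"
  shows "(\<Sum>j\<le>Suc i. trib_term (m + 3) (Suc i) j) =
    (\<Sum>j\<le>Suc i. trib_term (m + 2) (Suc i) j) + (\<Sum>j\<le>i. trib_term (m + 1) i j)
    + (\<Sum>j\<le>i. trib_term m i j)"
proof -
  have "(\<Sum>j\<le>Suc i. trib_term (m + 1) i j) = (\<Sum>j\<le>i. trib_term (m + 1) i j)"
    by (simp add: trib_term_def trib_weight_eq_0)
  moreover have "(\<Sum>j\<le>Suc i. case j of 0 \<Rightarrow> 0 | Suc k \<Rightarrow> trib_term m i k) =
      (\<Sum>j\<le>i. trib_term m i j)"
    by (subst sum.atMost_Suc_shift) simp
  ultimately show ?thesis
    by (simp only: trib_term_rec[OF assms] sum.distrib)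
qed

lemma inc_trib_lucas_rec:
  assumes "m > 0"
  shows "inc_trib_lucas (m + 3) (s + 1) =
    inc_trib_lucas (m + 2) (s + 1) + inc_trib_lucas (m + 1) s + inc_trib_lucas m s"
proof -
  \<comment> \<open>The row \<open>i = 0\<close>, not reached by the recurrence, contributes 1 to
    both sides.\<close>
  have "trib_term (m + 3) 0 0 = trib_term (m + 2) 0 0"
    by (simp add: trib_term_def trib_weight_0)
  moreover have "inc_trib_lucas k (s + 1) =
      trib_term k 0 0 + (\<Sum>i\<le>s. \<Sum>j\<le>Suc i. trib_term k (Suc i) j)" for k
    unfolding inc_trib_lucas_eq Suc_eq_plus1[symmetric] by (subst sum.atMost_Suc_shift) simp
  ultimately show ?thesis
    by (simp only: sum_trib_term_rec[OF assms] sum.distrib inc_trib_lucas_eq[of _ s] add.assoc)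
qed

theorem theorem6:
  fixes n h s :: nat
  assumes "n \<ge> 1" and "h \<ge> 1" and "s \<le> n div 2"
  shows "(\<Sum>i = 0..h - 1. inc_trib_lucas (n + i) s) =
    1 / 2 * (inc_trib_lucas (n + h + 2) (s + 1) - inc_trib_lucas (n + 2) (s + 1)
             + inc_trib_lucas n s - inc_trib_lucas (n + h) s)"
proof -
  \<comment> \<open>With this range the induction starts at the empty sum.\<close>
  have "(\<Sum>i<h. inc_trib_lucas (n + i) s) =
    1 / 2 * (inc_trib_lucas (n + h + 2) (s + 1) - inc_trib_lucas (n + 2) (s + 1)
             + inc_trib_lucas n s - inc_trib_lucas (n + h) s)"
  proof (induction h)
    case (Suc h)
    \<comment> \<open>Passing to \<open>Suc h\<close> thus raises the bracket by twice
      \<open>inc_trib_lucas (n + h) s\<close>, hence the factor 1/2.\<close>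
    have "inc_trib_lucas (n + Suc h + 2) (s + 1) = inc_trib_lucas (n + h + 2) (s + 1)
        + inc_trib_lucas (n + Suc h) s + inc_trib_lucas (n + h) s"
      using inc_trib_lucas_rec[of "n + h" s] assms(1) by (simp add: numeral_eq_Suc)
    with Suc show ?case by (simp add: field_simps)
  qed simp
  moreover have "{0..h - 1} = {..<h}" using assms(2) by auto
  ultimately show ?thesis by simp
qed

end
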